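(* Let $\mathcal{U}=\{\pmb{c}^1,\ldots,\pmb{c}^N\}\subseteq\mathbb{R}^n_+$ and let $\mathcal{C}=\{\hat{\pmb{c}}^1,\ldots,\hat{\pmb{c}}^K\}\subseteq\mathbb{R}^n_+$ be such that, for some $\alpha\ge 1$ and $\beta\ge 1$, (i) for all $i\in[N]$ there exists $k\in[K]$ such that $\pmb{c}^i\le\alpha\hat{\pmb{c}}^k$; and (ii) for all $k\in[K]$ there exists $i\in[N]$ such that $\hat{\pmb{c}}^k\le\beta\pmb{c}^i$. Then, for every feasible set $\mathcal{X}\subseteq\mathbb{R}^{n_x}_+\times\mathbb{R}^n_+$ and every first-stage cost vector $\pmb{C}\in\mathbb{R}^{n_x}_+$, any optimal solution to the two-stage robust optimization problem with respect to $\mathcal{C}$ is an $\alpha\beta$-approximation to the two-stage robust optimization problem with respect to $\mathcal{U}$.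
   Context: $[N]=\{1,\ldots,N\}$; $\mathbb{R}^n_+$ is the set of vectors in $\mathbb{R}^n$ with nonnegative entries; inequalities between vectors are componentwise. Let $\mathcal{X}\subseteq\mathbb{R}^{n_x}_+\times\mathbb{R}^n_+$ be the set of feasible solutions $(\pmb{x},\pmb{y})$, with here-and-now (first-stage) variables $\pmb{x}$ and wait-and-see (second-stage) variables $\pmb{y}$. Put $\mathcal{X}(\pmb{x})=\{\pmb{y}\in\mathbb{R}^n_+:(\pmb{x},\pmb{y})\in\mathcal{X}\}$ and $\mathcal{X}'=\{\pmb{x}\in\mathbb{R}^{n_x}_+:\mathcal{X}(\pmb{x})\neq\emptyset\}$. For a finite nonempty set $\mathcal{V}\subseteq\mathbb{R}^n_+$ write $F_{\mathcal{V}}(\pmb{x})=\max_{\pmb{c}\in\mathcal{V}}\min_{\pmb{y}\in\mathcal{X}(\pmb{x})}\left(\pmb{C}^\intercal\pmb{x}+\pmb{c}^\intercal\pmb{y}\right)$. The two-stage robust optimization problem with respect to $\mathcal{V}$ is $\min_{\pmb{x}\in\mathcal{X}'}F_{\mathcal{V}}(\pmb{x})$; a solution is a first-stage decision $\pmb{x}\in\mathcal{X}'$. For $\rho\ge 0$, $\hat{\pmb{x}}\in\mathcal{X}'$ is a $\rho$-approximation to the problem with respect to $\mathcal{U}$ if $F_{\mathcal{U}}(\hat{\pmb{x}})\le\rho\cdot\min_{\pmb{x}\in\mathcal{X}'}F_{\mathcal{U}}(\pmb{x})$. As throughout, the minima that are written are assumed to be attained. *)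

theory Defs
  imports "HOL-Analysis.Analysis"
begin

text \<open>
  The order on \<^typ>\<open>real ^ 'n\<close> is the library's componentwise order, so \<^prop>\<open>0 \<le> y\<close>
  says that all entries of \<^term>\<open>y\<close> are nonnegative.
\<close>

definition second_stage ::
    "((real ^ 'm) \<times> (real ^ 'n)) set \<Rightarrow> real ^ 'm \<Rightarrow> (real ^ 'n) set" where
  "second_stage X x = {y. 0 \<le> y \<and> (x, y) \<in> X}"

definition first_stage :: "((real ^ 'm) \<times> (real ^ 'n)) set \<Rightarrow> (real ^ 'm) set" where
  "first_stage X = {x. 0 \<le> x \<and> second_stage X x \<noteq> {}}"

text \<open>
  The minimum of \<^term>\<open>f\<close> over \<^term>\<open>S\<close>, as the least element of the image. It is
  unspecified when no least element exists, so its uses come with the assumption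
  \<^term>\<open>min_attained f S\<close>. (The library's \<^const>\<open>Min\<close> is only meaningful for finite sets.)
\<close>

definition min_over :: "('a \<Rightarrow> real) \<Rightarrow> 'a set \<Rightarrow> real" where
  "min_over f S = (LEAST v. v \<in> f ` S)"

definition min_attained :: "('a \<Rightarrow> real) \<Rightarrow> 'a set \<Rightarrow> bool" where
  "min_attained f S \<longleftrightarrow> (\<exists>x. is_arg_min f (\<lambda>x. x \<in> S) x)"

definition total_cost :: "real ^ 'm \<Rightarrow> real ^ 'm \<Rightarrow> real ^ 'n \<Rightarrow> real ^ 'n \<Rightarrow> real" where
  "total_cost C x c y = C \<bullet> x + c \<bullet> y"

definition robust_value ::
    "((real ^ 'm) \<times> (real ^ 'n)) set \<Rightarrow> real ^ 'm \<Rightarrow> (real ^ 'n) set \<Rightarrow> real ^ 'm \<Rightarrow> real" where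
  "robust_value X C V x = (MAX c\<in>V. min_over (total_cost C x c) (second_stage X x))"

definition optimal_solution ::
    "((real ^ 'm) \<times> (real ^ 'n)) set \<Rightarrow> real ^ 'm \<Rightarrow> (real ^ 'n) set \<Rightarrow> real ^ 'm \<Rightarrow> bool" where
  "optimal_solution X C V x \<longleftrightarrow> is_arg_min (robust_value X C V) (\<lambda>x. x \<in> first_stage X) x"

definition approximation ::
    "real \<Rightarrow> ((real ^ 'm) \<times> (real ^ 'n)) set \<Rightarrow> real ^ 'm \<Rightarrow> (real ^ 'n) set \<Rightarrow> real ^ 'm \<Rightarrow> bool"
  where
  "approximation \<rho> X C V x \<longleftrightarrow>
     x \<in> first_stage X \<and>
     robust_value X C V x \<le> \<rho> * min_over (robust_value X C V) (first_stage X)"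

end

theory Submission
  imports Defs
begin

text \<open>
  Call a scenario set \<open>V\<close> dominated up to the factor \<open>\<rho>\<close> by \<open>W\<close> if every \<open>v\<close> in \<open>V\<close> satisfies
  \<open>v \<le> \<rho> w\<close> for some \<open>w\<close> in \<open>W\<close>. Since first-stage costs and second-stage solutions are
  nonnegative, \<open>v \<le> \<rho> w\<close> with \<open>\<rho> \<ge> 1\<close> gives \<open>C x + v y \<le> \<rho> (C x + w y)\<close> for every feasible
  \<open>(x, y)\<close>: here \<open>\<rho> \<ge> 1\<close> pays for the first-stage cost, which is the same under both scenarios.
  The inequality survives minimizing over \<open>y\<close> and maximizing over scenarios, so domination bounds
  the two robust values by the factor \<open>\<rho>\<close> at each fixed \<open>x\<close> (\<open>robust_value_le_of_dominated\<close>).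

  Conditions (i) and (ii) say that \<open>\<C>\<close> dominates \<open>U\<close> up to \<open>\<alpha>\<close> and that \<open>U\<close> dominates \<open>\<C>\<close> up to
  \<open>\<beta>\<close>. If \<open>x\<^sub>0\<close> is optimal for \<open>U\<close> and \<open>x_hat\<close> for \<open>\<C>\<close>, then, writing \<open>F\<close> for the robust value,
  \<open>F\<^sub>U x_hat \<le> \<alpha> F\<^sub>\<C> x_hat \<le> \<alpha> F\<^sub>\<C> x\<^sub>0 \<le> \<alpha> \<beta> F\<^sub>U x\<^sub>0\<close>.
\<close>

lemma min_over_is_arg_min:
  assumes "is_arg_min f (\<lambda>x. x \<in> S) x"
  shows "min_over f S = f x"
  unfolding min_over_def using assms
  by (intro Least_equality) (auto simp: is_arg_min_linorder)

lemma total_cost_le_of_scaled_scenario: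
  fixes C x :: "real ^ 'm" and v w y :: "real ^ 'n"
  assumes "0 \<le> C" "0 \<le> x" "0 \<le> y" "1 \<le> \<rho>" "v \<le> \<rho> *\<^sub>R w"
  shows "total_cost C x v y \<le> \<rho> * total_cost C x w y"
proof -
  have "1 * (C \<bullet> x) \<le> \<rho> * (C \<bullet> x)"
    using assms by (intro mult_right_mono inner_nonneg_nonneg)
  moreover have "0 \<le> (\<rho> *\<^sub>R w - v) \<bullet> y"
    using assms by (intro inner_nonneg_nonneg) simp_all
  ultimately show ?thesis
    by (simp add: total_cost_def inner_diff_left distrib_left)
qed

text \<open>
  A minimizer for the dominating scenario is feasible for the dominated one, so evaluating both
  costs there carries the pointwise bound over to the minima.
\<close>

lemma min_total_cost_le_of_scaled_scenario:
  assumes "0 \<le> C" "0 \<le> x" "1 \<le> \<rho>" "v \<le> \<rho> *\<^sub>R w"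
    and "min_attained (total_cost C x v) (second_stage X x)"
    and "min_attained (total_cost C x w) (second_stage X x)"
  shows "min_over (total_cost C x v) (second_stage X x)
       \<le> \<rho> * min_over (total_cost C x w) (second_stage X x)"
proof -
  obtain y where y: "is_arg_min (total_cost C x v) (\<lambda>y. y \<in> second_stage X x) y"
    using assms(5) unfolding min_attained_def by blast
  obtain z where z: "is_arg_min (total_cost C x w) (\<lambda>y. y \<in> second_stage X x) z"
    using assms(6) unfolding min_attained_def by blast
  then have "z \<in> second_stage X x"
    by (simp add: is_arg_min_linorder)
  then have "total_cost C x v y \<le> total_cost C x v z"
    using y by (simp add: is_arg_min_linorder)
  also have "\<dots> \<le> \<rho> * total_cost C x w z"
    using assms \<open>z \<in> second_stage X x\<close>
    by (intro total_cost_le_of_scaled_scenario) (auto simp: second_stage_def)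
  finally show ?thesis
    by (simp add: min_over_is_arg_min[OF y] min_over_is_arg_min[OF z])
qed

lemma robust_value_le_of_dominated:
  assumes "finite V" "V \<noteq> {}" "finite W"
    and "0 \<le> C" "x \<in> first_stage X" "1 \<le> \<rho>"
    and dominated: "\<And>v. v \<in> V \<Longrightarrow> \<exists>w\<in>W. v \<le> \<rho> *\<^sub>R w"
    and attained: "\<And>v. v \<in> V \<union> W \<Longrightarrow> min_attained (total_cost C x v) (second_stage X x)"
  shows "robust_value X C V x \<le> \<rho> * robust_value X C W x"
proof -
  have "min_over (total_cost C x v) (second_stage X x) \<le> \<rho> * robust_value X C W x"
    if v: "v \<in> V" for v
  proof -
    obtain w where w: "w \<in> W" "v \<le> \<rho> *\<^sub>R w"
      using dominated[OF v] by blast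
    have "min_over (total_cost C x v) (second_stage X x)
        \<le> \<rho> * min_over (total_cost C x w) (second_stage X x)"
      using assms(4-6) w v
      by (intro min_total_cost_le_of_scaled_scenario attained) (auto simp: first_stage_def)
    also have "\<dots> \<le> \<rho> * robust_value X C W x"
      unfolding robust_value_def using assms(3,6) w(1) by (intro mult_left_mono Max_ge) auto
    finally show ?thesis .
  qed
  then show ?thesis
    using assms(1,2) by (simp add: robust_value_def[of X C V])
qed

theorem theorem9:
  fixes c c_hat :: "nat \<Rightarrow> real ^ 'n"
    and N K :: nat
    and \<alpha> \<beta> :: real
    and X :: "((real ^ 'm) \<times> (real ^ 'n)) set"
    and C :: "real ^ 'm"
    and U \<C> :: "(real ^ 'n) set"
    and x_hat :: "real ^ 'm"
  assumes "N \<ge> 1" and "K \<ge> 1"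
    and U: "U = c ` {1..N}" "U \<subseteq> {v. 0 \<le> v}"
    and \<C>: "\<C> = c_hat ` {1..K}" "\<C> \<subseteq> {v. 0 \<le> v}"
    and "\<alpha> \<ge> 1" and "\<beta> \<ge> 1"
    and i: "\<forall>i\<in>{1..N}. \<exists>k\<in>{1..K}. c i \<le> \<alpha> *\<^sub>R c_hat k"
    and ii: "\<forall>k\<in>{1..K}. \<exists>i\<in>{1..N}. c_hat k \<le> \<beta> *\<^sub>R c i"
    and X: "X \<subseteq> {x. 0 \<le> x} \<times> {y. 0 \<le> y}"
    and C: "0 \<le> C"
    and inner_min: "\<forall>x\<in>first_stage X. \<forall>v\<in>U \<union> \<C>.
          min_attained (total_cost C x v) (second_stage X x)"
    and outer_min: "min_attained (robust_value X C U) (first_stage X)"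
    and opt: "optimal_solution X C \<C> x_hat"
  shows "approximation (\<alpha> * \<beta>) X C U x_hat"
proof -
  obtain x0 where x0: "is_arg_min (robust_value X C U) (\<lambda>x. x \<in> first_stage X) x0"
    using outer_min unfolding min_attained_def by blast
  then have x0_feasible: "x0 \<in> first_stage X"
    by (simp add: is_arg_min_linorder)
  have x_hat_feasible: "x_hat \<in> first_stage X"
    using opt by (simp add: optimal_solution_def is_arg_min_linorder)
  have "robust_value X C U x_hat \<le> \<alpha> * robust_value X C \<C> x_hat"
    using \<open>N \<ge> 1\<close> U(1) \<C>(1) C x_hat_feasible \<open>\<alpha> \<ge> 1\<close> i inner_min
    by (intro robust_value_le_of_dominated) auto
  also have "\<dots> \<le> \<alpha> * robust_value X C \<C> x0"
    using opt x0_feasible \<open>\<alpha> \<ge> 1\<close>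
    by (intro mult_left_mono) (auto simp: optimal_solution_def is_arg_min_linorder)
  also have "\<dots> \<le> \<alpha> * (\<beta> * robust_value X C U x0)"
  proof (rule mult_left_mono)
    show "robust_value X C \<C> x0 \<le> \<beta> * robust_value X C U x0"
      using \<open>K \<ge> 1\<close> U(1) \<C>(1) C x0_feasible \<open>\<beta> \<ge> 1\<close> ii inner_min
      by (intro robust_value_le_of_dominated) auto
  qed (use \<open>\<alpha> \<ge> 1\<close> in simp)
  finally show ?thesis
    using x_hat_feasible by (simp add: approximation_def min_over_is_arg_min[OF x0] mult.assoc)
qed

end
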